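(* Let $(X,d)$ be a totally bounded ultrametric space with $|X|\geq 2$. Then there is an integer $k\geq 2$ such that the diametrical graph $G_{X,d}$ is complete $k$-partite.
   Context: An ultrametric on $X$ is a metric $d$ with $d(x,y)\leq\max\{d(x,z),d(z,y)\}$ for all $x,y,z\in X$. A metric space is totally bounded if for every $r>0$ there are finitely many open balls $B_r(x_i)=\{x\in X:d(x_i,x)<r\}$, $x_i\in X$, of radius $r$ covering $X$. A (simple) graph $G$ is complete $k$-partite, $k \geq 2$, if its vertex set can be partitioned into $k$ nonempty disjoint subsets (parts) such that no edge has both ends in the same part and any two vertices in different parts are adjacent. With $\operatorname{diam} X=\sup\{d(x,y): x,y\in X\}\in[0,\infty]$, the diametrical graph $G_{X,d}$ is the simple graph with vertex set $X$ in which $\{u,v\}$ is an edge iff $u\neq v$ and $d(u,v)=\operatorname{diam} X$. *)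

theory Defs
  imports "HOL-Analysis.Analysis" "HOL-Library.Disjoint_Sets"
begin

section \<open>Ultrametric spaces\<close>

text \<open>
  As in the library locale \<^locale>\<open>Metric_space\<close>, the metric is a total function on the
  ambient type, which is required to be nonnegative and symmetric everywhere; this is no
  restriction on its values on \<^term>\<open>M \<times> M\<close>.
\<close>

locale Ultrametric_space = Metric_space +
  assumes ultrametric: "\<lbrakk>x \<in> M; y \<in> M; z \<in> M\<rbrakk> \<Longrightarrow> d x y \<le> max (d x z) (d z y)"

section \<open>Simple graphs\<close>

text \<open>A graph is a pair of a vertex set, possibly infinite, and a set of edges.\<close>

type_synonym 'a graph = "'a set \<times> 'a set set"

definition simple_graph :: "'a graph \<Rightarrow> bool" where
  "simple_graph = (\<lambda>(V, E). \<forall>e\<in>E. \<exists>u\<in>V. \<exists>v\<in>V. u \<noteq> v \<and> e = {u, v})"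

text \<open>As \<open>k \<ge> 2\<close>, the condition \<^prop>\<open>card P = k\<close> forces \<open>P\<close> to be finite.\<close>

definition complete_partite :: "nat \<Rightarrow> 'a graph \<Rightarrow> bool" where
  "complete_partite k = (\<lambda>(V, E). simple_graph (V, E) \<and> k \<ge> 2 \<and>
     (\<exists>P. partition_on V P \<and> card P = k \<and>
          (\<forall>A\<in>P. \<forall>u\<in>A. \<forall>v\<in>A. {u, v} \<notin> E) \<and>
          (\<forall>A\<in>P. \<forall>B\<in>P. A \<noteq> B \<longrightarrow> (\<forall>u\<in>A. \<forall>v\<in>B. {u, v} \<in> E))))"

section \<open>The diametrical graph\<close>

text \<open>
  The diameter takes values in $[0,\infty]$. The library function \<^const>\<open>diameter\<close> is real-valued
  and returns 0 on unbounded sets.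
\<close>

definition diam :: "'a set \<Rightarrow> ('a \<Rightarrow> 'a \<Rightarrow> real) \<Rightarrow> ennreal" where
  "diam X d = (SUP (x, y) \<in> X \<times> X. ennreal (d x y))"

definition diametrical_graph :: "'a set \<Rightarrow> ('a \<Rightarrow> 'a \<Rightarrow> real) \<Rightarrow> 'a graph" where
  "diametrical_graph X d =
     (X, {{u, v} |u v. u \<in> X \<and> v \<in> X \<and> u \<noteq> v \<and> ennreal (d u v) = diam X d})"

end

theory Submission
  imports Defs
begin

text \<open>
  Fix \<open>a \<noteq> b\<close>, put \<open>r = d a b\<close> and take a finite \<open>r\<close>-net \<open>K\<close>. By the strong triangle inequality
  every distance is at most \<open>r\<close> or at most a distance between two points of \<open>K\<close>, so the diameter
  \<open>D\<close> is finite, positive and attained on the finite set \<open>K \<union> {a, b}\<close>. The relation \<open>d x y < D\<close> is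
  an equivalence relation whose classes are the parts; as \<open>r \<le> D\<close>, each of them meets \<open>K\<close>.
\<close>

context Ultrametric_space
begin

lemma less_trans_ultrametric:
  assumes "x \<in> M" "y \<in> M" "z \<in> M" "d x z < r" "d z y < r"
  shows "d x y < r"
  using ultrametric[OF assms(1-3)] assms(4,5) by linarith

text \<open>The strict inequality makes the class of a point the open ball about it. With
  \<open>r\<close> the attained diameter, being unrelated then means lying at exactly that
  distance.\<close>

definition ball_rel :: "real \<Rightarrow> ('a \<times> 'a) set" where
  "ball_rel r = {(x, y). x \<in> M \<and> y \<in> M \<and> d x y < r}"

lemma equiv_ball_rel:
  assumes "r > 0"
  shows "equiv M (ball_rel r)"
proof (rule equivI)
  show "ball_rel r \<subseteq> M \<times> M" by (auto simp: ball_rel_def)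
  show "refl_on M (ball_rel r)" using assms by (auto simp: refl_on_def ball_rel_def)
  show "sym (ball_rel r)" by (auto simp: sym_def ball_rel_def commute)
  show "trans (ball_rel r)"
    using less_trans_ultrametric by (simp add: trans_def ball_rel_def) blast
qed

text \<open>Take a net of the same radius \<open>r\<close>: a point in the ball about a centre is
  equivalent to that centre, so every class is the class of one of finitely many centres.\<close>

lemma finite_quotient_ball_rel:
  assumes "mtotally_bounded M" "r > 0"
  shows "finite (M // ball_rel r)"
proof -
  obtain K where K: "finite K" "K \<subseteq> M" "M \<subseteq> (\<Union>x\<in>K. mball x r)"
    using assms unfolding mtotally_bounded_def by meson
  have "M // ball_rel r \<subseteq> (\<lambda>x. ball_rel r `` {x}) ` K"
  proof
    fix A assume "A \<in> M // ball_rel r"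
    then obtain x where x: "x \<in> M" "A = ball_rel r `` {x}"
      by (auto elim: quotientE)
    then obtain p where p: "p \<in> K" "x \<in> mball p r" using K(3) by blast
    then have "(p, x) \<in> ball_rel r" by (auto simp: ball_rel_def)
    then have "A = ball_rel r `` {p}"
      using equiv_class_eq[OF equiv_ball_rel[OF \<open>r > 0\<close>]] x(2) by simp
    with p(1) show "A \<in> (\<lambda>x. ball_rel r `` {x}) ` K" by blast
  qed
  then show ?thesis using K(1) finite_surj by blast
qed

lemma diam_attained:
  assumes "mtotally_bounded M" "a \<in> M" "b \<in> M" "a \<noteq> b"
  obtains p q where "p \<in> M" "q \<in> M" "d p q > 0" "\<And>x y. x \<in> M \<Longrightarrow> y \<in> M \<Longrightarrow> d x y \<le> d p q"
proof -
  define r where "r = d a b"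
  have "r > 0" using assms by (simp add: r_def)
  obtain K where K: "finite K" "K \<subseteq> M" "M \<subseteq> (\<Union>x\<in>K. mball x r)"
    using assms(1) \<open>r > 0\<close> unfolding mtotally_bounded_def by meson
  \<comment> \<open>Adjoining \<open>a\<close> and \<open>b\<close> puts \<open>r\<close> itself
    among the values in \<open>S\<close>, so \<open>Max S\<close> dominates the error of
    approximating points by the net.\<close>
  define L where "L = K \<union> {a, b}"
  define S where "S = (\<lambda>(x, y). d x y) ` (L \<times> L)"
  have S: "finite S" "S \<noteq> {}" using K(1) by (auto simp: S_def L_def)
  have L: "d x y \<le> Max S" if "x \<in> L" "y \<in> L" for x y
    using that S(1) by (intro Max_ge) (auto simp: S_def)
  have "r \<le> Max S" unfolding r_def by (rule L) (auto simp: L_def)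
  have bound: "d x y \<le> Max S" if xy: "x \<in> M" "y \<in> M" for x y
  proof -
    obtain p q where p: "p \<in> K" "x \<in> mball p r" and q: "q \<in> K" "y \<in> mball q r"
      using K(3) xy by blast
    have "d p q \<le> Max S" using p q by (intro L) (auto simp: L_def)
    moreover have "d x p < r" "d q y < r" using p q by (auto simp: commute)
    moreover have "p \<in> M" "q \<in> M" using p q by auto
    \<comment> \<open>Two strong triangle inequalities along \<open>x\<close>, \<open>p\<close>,
      \<open>q\<close>, \<open>y\<close> bound \<open>d x y\<close> by the largest of
      \<open>d x p\<close>, \<open>d p q\<close> and \<open>d q y\<close>.\<close>
    ultimately show ?thesis
      using ultrametric[of x y p] ultrametric[of p y q] xy \<open>r \<le> Max S\<close> by auto
  qed
  obtain p q where pq: "p \<in> L" "q \<in> L" "Max S = d p q"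
    using Max_in[OF S] by (auto simp: S_def)
  show thesis
  proof (rule that[of p q])
    show "p \<in> M" "q \<in> M" using pq K(2) assms(2,3) by (auto simp: L_def)
    show "d p q > 0" using pq(3) \<open>r > 0\<close> \<open>r \<le> Max S\<close> by linarith
    show "d x y \<le> d p q" if "x \<in> M" "y \<in> M" for x y using bound[OF that] pq(3) by simp
  qed
qed

lemma diam_eqI:
  assumes "p \<in> M" "q \<in> M" "\<And>x y. x \<in> M \<Longrightarrow> y \<in> M \<Longrightarrow> d x y \<le> d p q"
  shows "diam M d = ennreal (d p q)"
  unfolding diam_def
proof (rule antisym)
  show "(SUP (x, y)\<in>M \<times> M. ennreal (d x y)) \<le> ennreal (d p q)"
    using assms(3) by (auto intro!: SUP_least ennreal_leI)
  show "ennreal (d p q) \<le> (SUP (x, y)\<in>M \<times> M. ennreal (d x y))"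
    using assms(1,2) by (intro SUP_upper2[of "(p, q)"]) auto
qed

end

theorem proposition3p5:
  fixes X :: "'a set" and d :: "'a \<Rightarrow> 'a \<Rightarrow> real"
  assumes "Ultrametric_space X d"
    and "Metric_space.mtotally_bounded X d X"
    and "\<exists>x\<in>X. \<exists>y\<in>X. x \<noteq> y"
  shows "\<exists>k\<ge>2. complete_partite k (diametrical_graph X d)"
proof -
  interpret Ultrametric_space X d by fact
  obtain p q where pq: "p \<in> X" "q \<in> X" "d p q > 0"
    and max: "\<And>x y. x \<in> X \<Longrightarrow> y \<in> X \<Longrightarrow> d x y \<le> d p q"
    using diam_attained assms(2,3) by metis
  define R where "R = ball_rel (d p q)"
  define E where "E = {{u, v} |u v. u \<in> X \<and> v \<in> X \<and> u \<noteq> v \<and> ennreal (d u v) = diam X d}"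
  have R: "equiv X R" unfolding R_def using pq by (intro equiv_ball_rel)
  have fin: "finite (X // R)"
    unfolding R_def using assms(2) pq(3) by (rule finite_quotient_ball_rel)
  have E_iff: "{u, v} \<in> E \<longleftrightarrow> (u, v) \<notin> R" if "u \<in> X" "v \<in> X" for u v
  proof -
    \<comment> \<open>Distances are nonnegative, so \<open>ennreal\<close> does not identify
      distinct values here.\<close>
    have "ennreal (d x y) = diam X d \<longleftrightarrow> d x y = d p q" for x y
      by (simp add: diam_eqI[OF pq(1,2) max])
    then have "{u, v} \<in> E \<longleftrightarrow> u \<noteq> v \<and> d u v = d p q"
      using that unfolding E_def by (auto simp: doubleton_eq_iff commute)
    \<comment> \<open>By maximality of \<open>d p q\<close>, equality is the negation of
      \<open><\<close>; since \<open>d p q > 0\<close>, it also forces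
      \<open>u \<noteq> v\<close>.\<close>
    also have "\<dots> \<longleftrightarrow> (u, v) \<notin> R"
      using that max[OF that] pq(3) by (auto simp: R_def ball_rel_def)
    finally show ?thesis .
  qed
  \<comment> \<open>The points \<open>p\<close> and \<open>q\<close> realise the diameter, so they
    are unrelated and supply two distinct parts.\<close>
  have "{R `` {p}, R `` {q}} \<subseteq> X // R" using pq by (auto intro: quotientI)
  moreover have "R `` {p} \<noteq> R `` {q}"
    using eq_equiv_class_iff[OF R pq(1,2)] by (simp add: R_def ball_rel_def)
  ultimately have card: "card (X // R) \<ge> 2"
    using card_mono[OF fin, of "{R `` {p}, R `` {q}}"] by simp
  have "simple_graph (X, E)" by (auto simp: simple_graph_def E_def)
  moreover have "partition_on X (X // R)" using R by (rule partition_on_quotient)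
  moreover have "{u, v} \<notin> E" if "A \<in> X // R" "u \<in> A" "v \<in> A" for A u v
  proof -
    have "u \<in> X" "v \<in> X" using that in_quotient_imp_subset[OF R] by auto
    moreover have "(u, v) \<in> R" using quotient_eq_iff[OF R that(1,1,2,3)] by simp
    ultimately show ?thesis using E_iff by simp
  qed
  moreover have "{u, v} \<in> E" if "A \<in> X // R" "B \<in> X // R" "A \<noteq> B" "u \<in> A" "v \<in> B" for A B u v
  proof -
    have "u \<in> X" "v \<in> X" using that in_quotient_imp_subset[OF R] by auto
    moreover have "(u, v) \<notin> R" using quotient_eq_iff[OF R that(1,2,4,5)] that(3) by simp
    ultimately show ?thesis using E_iff by simp
  qed
  ultimately have "complete_partite (card (X // R)) (X, E)"
    using card unfolding complete_partite_def prod.case by blast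
  then show ?thesis using card by (auto simp: diametrical_graph_def E_def)
qed

end
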